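(* Fix real numbers $c<d$. None of the topological spaces $\mathrm{(ffid^{[c,d]})}$, $\mathrm{(ffid)}$, $\mathrm{(fid)}$, $\mathrm{(cfid)}$, $\mathrm{(cid)}$, $\mathrm{(pfd)}$, $\mathrm{(rid)}$, with the topology induced by the interleaving distance, is a $T_0$-space.
   Context: Fix a field $\mathbf{k}$. A persistence module is a functor $M:(\mathbb{R},\le)\to \mathrm{Vect}_{\mathbf{k}}$; "persistence module" means isomorphism class. For an interval $J\subset\mathbb{R}$, the interval module $J$ is $\mathbf{k}$ at points of $J$ and $0$ elsewhere, with identity maps between points of $J$ and zero maps otherwise. For $\varepsilon\ge 0$, $M,N$ are $\varepsilon$-interleaved if there are families of linear maps $\varphi_a:M(a)\to N(a+\varepsilon)$ and $\psi_a:N(a)\to M(a+\varepsilon)$, natural in $a\in\mathbb{R}$, with $\psi_{a+\varepsilon}\varphi_a=M(a\le a+2\varepsilon)$ and $\varphi_{a+\varepsilon}\psi_a=N(a\le a+2\varepsilon)$ for all $a$. The interleaving distance is $d_I(M,N)=\inf\{\varepsilon\ge0 : M,N \text{ are } \varepsilon\text{-interleaved}\}$ ($\infty$ if there is none). It is an extended pseudometric; the induced topology has the open balls $B_r(M)=\{N: d_I(M,N)<r\}$, $r>0$, as a base. Sets of persistence modules: $\mathrm{(fid)}$: finite direct sums of interval modules (including the zero module); $\mathrm{(ffid)}$: those in $\mathrm{(fid)}$ with all intervals finite (bounded); $\mathrm{(ffid^{[c,d]})}$: those in $\mathrm{(ffid)}$ with all intervals contained in $[c,d]$; $\mathrm{(cid)}$: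 direct sums of countably many interval modules; $\mathrm{(cfid)}$: those in $\mathrm{(cid)}$ with all intervals finite (bounded); $\mathrm{(pfd)}$: persistence modules $M$ with every $M(a)$ finite dimensional; $\mathrm{(rid)}$: direct sums $\bigoplus_{\alpha\in A}I_\alpha$ of interval modules with $|A|\le|\mathbb{R}|$. A topological space is $T_0$ if for any two distinct points some open set contains exactly one of them. *)

theory Defs
  imports "HOL-Analysis.Analysis" "HOL-Algebra.Module" "HOL-Algebra.Product_Groups"
begin

section \<open>Vector spaces\<close>

text \<open>A vector space over a field \<open>K\<close> is a unital module over \<open>K\<close>; \<open>module\<close> alone would be
  ambiguous with the locale of the same name in \<open>HOL.Modules\<close>.\<close>

definition linear_map ::
    "('k, 'm) ring_scheme \<Rightarrow> ('k, 'v) module \<Rightarrow> ('k, 'w) module \<Rightarrow> ('v \<Rightarrow> 'w) \<Rightarrow> bool" where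
  "linear_map K V W f \<longleftrightarrow>
     f \<in> carrier V \<rightarrow> carrier W \<and>
     (\<forall>x\<in>carrier V. \<forall>y\<in>carrier V. f (x \<oplus>\<^bsub>V\<^esub> y) = f x \<oplus>\<^bsub>W\<^esub> f y) \<and>
     (\<forall>r\<in>carrier K. \<forall>x\<in>carrier V. f (r \<odot>\<^bsub>V\<^esub> x) = r \<odot>\<^bsub>W\<^esub> f x)"

definition fin_dim :: "('k, 'm) ring_scheme \<Rightarrow> ('k, 'v) module \<Rightarrow> bool" where
  "fin_dim K V \<longleftrightarrow>
     (\<exists>B. finite B \<and> B \<subseteq> carrier V \<and>
        (\<forall>x\<in>carrier V. \<exists>r \<in> B \<rightarrow> carrier K. x = (\<Oplus>\<^bsub>V\<^esub>b\<in>B. r b \<odot>\<^bsub>V\<^esub> b)))"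

section \<open>Persistence modules\<close>

text \<open>\<open>obj M a\<close> is the vector space \<open>M(a)\<close> and \<open>tr M a b\<close> is the linear map \<open>M(a \<le> b)\<close>. The values
  of \<open>tr M a b\<close> for \<open>b < a\<close> or outside the carrier of \<open>obj M a\<close> are irrelevant; representations
  differing only there are isomorphic, hence identified below.\<close>

record ('k, 'v) pmod =
  obj :: "real \<Rightarrow> ('k, 'v) module"
  tr :: "real \<Rightarrow> real \<Rightarrow> 'v \<Rightarrow> 'v"

definition persistence_module :: "('k, 'm) ring_scheme \<Rightarrow> ('k, 'v) pmod \<Rightarrow> bool" where
  "persistence_module K M \<longleftrightarrow>
     (\<forall>a. Module.module K (obj M a)) \<and>
     (\<forall>a b. a \<le> b \<longrightarrow> linear_map K (obj M a) (obj M b) (tr M a b)) \<and>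
     (\<forall>a. \<forall>x\<in>carrier (obj M a). tr M a a x = x) \<and>
     (\<forall>a b c. a \<le> b \<longrightarrow> b \<le> c \<longrightarrow>
        (\<forall>x\<in>carrier (obj M a). tr M b c (tr M a b x) = tr M a c x))"

text \<open>A morphism of degree \<open>\<epsilon>\<close> is a natural family \<open>\<phi>\<^sub>a : M(a) \<rightarrow> N(a + \<epsilon>)\<close>.\<close>

definition shift_morphism ::
    "('k, 'm) ring_scheme \<Rightarrow> real \<Rightarrow> ('k, 'v) pmod \<Rightarrow> ('k, 'w) pmod \<Rightarrow> (real \<Rightarrow> 'v \<Rightarrow> 'w) \<Rightarrow> bool" where
  "shift_morphism K \<epsilon> M N \<phi> \<longleftrightarrow>
     (\<forall>a. linear_map K (obj M a) (obj N (a + \<epsilon>)) (\<phi> a)) \<and>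
     (\<forall>a b. a \<le> b \<longrightarrow>
        (\<forall>x\<in>carrier (obj M a). \<phi> b (tr M a b x) = tr N (a + \<epsilon>) (b + \<epsilon>) (\<phi> a x)))"

definition pm_iso :: "('k, 'm) ring_scheme \<Rightarrow> ('k, 'v) pmod \<Rightarrow> ('k, 'w) pmod \<Rightarrow> bool" where
  "pm_iso K M N \<longleftrightarrow>
     (\<exists>\<phi>. shift_morphism K 0 M N \<phi> \<and>
        (\<forall>a. bij_betw (\<phi> a) (carrier (obj M a)) (carrier (obj N a))))"

definition interleaved ::
    "('k, 'm) ring_scheme \<Rightarrow> real \<Rightarrow> ('k, 'v) pmod \<Rightarrow> ('k, 'w) pmod \<Rightarrow> bool" where
  "interleaved K \<epsilon> M N \<longleftrightarrow>
     (\<exists>\<phi> \<psi>. shift_morphism K \<epsilon> M N \<phi> \<and> shift_morphism K \<epsilon> N M \<psi> \<and>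
        (\<forall>a. \<forall>x\<in>carrier (obj M a). \<psi> (a + \<epsilon>) (\<phi> a x) = tr M a (a + 2 * \<epsilon>) x) \<and>
        (\<forall>a. \<forall>x\<in>carrier (obj N a). \<phi> (a + \<epsilon>) (\<psi> a x) = tr N a (a + 2 * \<epsilon>) x))"

definition interleaving_distance ::
    "('k, 'm) ring_scheme \<Rightarrow> ('k, 'v) pmod \<Rightarrow> ('k, 'w) pmod \<Rightarrow> ereal" where
  "interleaving_distance K M N = Inf {ereal \<epsilon> |\<epsilon>. 0 \<le> \<epsilon> \<and> interleaved K \<epsilon> M N}"

section \<open>Interval modules and direct sums\<close>

definition interval_module :: "('k, 'm) ring_scheme \<Rightarrow> real set \<Rightarrow> ('k, 'k) pmod" where
  "interval_module K J =
     \<lparr>obj = (\<lambda>a. \<lparr>carrier = (if a \<in> J then carrier K else {\<zero>\<^bsub>K\<^esub>}),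
                   monoid.mult = (\<otimes>\<^bsub>K\<^esub>), monoid.one = \<one>\<^bsub>K\<^esub>, ring.zero = \<zero>\<^bsub>K\<^esub>, ring.add = (\<oplus>\<^bsub>K\<^esub>),
                   smult = (\<otimes>\<^bsub>K\<^esub>)\<rparr>),
      tr = (\<lambda>a b x. if a \<in> J \<and> b \<in> J then x else \<zero>\<^bsub>K\<^esub>)\<rparr>"

text \<open>Direct sums are formed pointwise, from the finitely supported families, as in
  \<^const>\<open>sum_group\<close>. The fields \<open>monoid.mult\<close> and \<open>monoid.one\<close>, inherited from ring records, play no role
  in a module.\<close>

definition pm_direct_sum :: "'i set \<Rightarrow> ('i \<Rightarrow> ('k, 'v) pmod) \<Rightarrow> ('k, 'i \<Rightarrow> 'v) pmod" where
  "pm_direct_sum A N =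
     \<lparr>obj = (\<lambda>a. \<lparr>carrier = {x \<in> \<Pi>\<^sub>E i\<in>A. carrier (obj (N i) a).
                              finite {i \<in> A. x i \<noteq> \<zero>\<^bsub>obj (N i) a\<^esub>}},
                   monoid.mult = (\<lambda>x y. \<lambda>i\<in>A. x i \<otimes>\<^bsub>obj (N i) a\<^esub> y i),
                   monoid.one = (\<lambda>i\<in>A. \<one>\<^bsub>obj (N i) a\<^esub>),
                   ring.zero = (\<lambda>i\<in>A. \<zero>\<^bsub>obj (N i) a\<^esub>),
                   ring.add = (\<lambda>x y. \<lambda>i\<in>A. x i \<oplus>\<^bsub>obj (N i) a\<^esub> y i),
                   smult = (\<lambda>r x. \<lambda>i\<in>A. r \<odot>\<^bsub>obj (N i) a\<^esub> x i)\<rparr>),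
      tr = (\<lambda>a b x. \<lambda>i\<in>A. tr (N i) a b (x i))\<rparr>"

text \<open>\<open>P\<close> restricts the size of the index set and \<open>Q\<close> the intervals (which are allowed to be
  degenerate). Only the cardinality of the index set matters and all sizes in question are at
  most that of the continuum, so index sets of real numbers suffice.\<close>

definition interval_decomposable ::
    "('k, 'm) ring_scheme \<Rightarrow> (real set \<Rightarrow> bool) \<Rightarrow> (real set \<Rightarrow> bool) \<Rightarrow> ('k, 'v) pmod \<Rightarrow> bool" where
  "interval_decomposable K P Q M \<longleftrightarrow>
     persistence_module K M \<and>
     (\<exists>A J. P A \<and> (\<forall>\<alpha>\<in>A. is_interval (J \<alpha>) \<and> J \<alpha> \<noteq> {} \<and> Q (J \<alpha>)) \<and>
        pm_iso K M (pm_direct_sum A (\<lambda>\<alpha>. interval_module K (J \<alpha>))))"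

section \<open>Isomorphism classes and sets of persistence modules\<close>

text \<open>From here on all vector spaces have carriers contained in the type \<open>real \<Rightarrow> 'k\<close>, where
  \<open>carrier K\<close> is a subset of \<open>'k\<close>. A vector space over \<open>K\<close> of dimension at most that of the
  continuum is isomorphic to the space of finitely supported functions from a set of real numbers
  to \<open>K\<close>, so every persistence module belonging to one of the sets below has an isomorphic copy
  of this kind, and no isomorphism class is lost.\<close>

type_synonym 'k cpmod = "('k, real \<Rightarrow> 'k) pmod"

definition iso_rel :: "('k, 'm) ring_scheme \<Rightarrow> ('k cpmod \<times> 'k cpmod) set" where
  "iso_rel K = {(M, N). persistence_module K M \<and> persistence_module K N \<and> pm_iso K M N}"

definition fid :: "('k, 'm) ring_scheme \<Rightarrow> 'k cpmod set set" where
  "fid K = {M. interval_decomposable K finite (\<lambda>J. True) M} // iso_rel K"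

definition ffid :: "('k, 'm) ring_scheme \<Rightarrow> 'k cpmod set set" where
  "ffid K = {M. interval_decomposable K finite bounded M} // iso_rel K"

definition ffid_within :: "('k, 'm) ring_scheme \<Rightarrow> real \<Rightarrow> real \<Rightarrow> 'k cpmod set set" where
  "ffid_within K c d =
     {M. interval_decomposable K finite (\<lambda>J. bounded J \<and> J \<subseteq> {c..d}) M} // iso_rel K"

definition cid :: "('k, 'm) ring_scheme \<Rightarrow> 'k cpmod set set" where
  "cid K = {M. interval_decomposable K countable (\<lambda>J. True) M} // iso_rel K"

definition cfid :: "('k, 'm) ring_scheme \<Rightarrow> 'k cpmod set set" where
  "cfid K = {M. interval_decomposable K countable bounded M} // iso_rel K"

definition pfd :: "('k, 'm) ring_scheme \<Rightarrow> 'k cpmod set set" where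
  "pfd K = {M. persistence_module K M \<and> (\<forall>a. fin_dim K (obj M a))} // iso_rel K"

definition rid :: "('k, 'm) ring_scheme \<Rightarrow> 'k cpmod set set" where
  "rid K = {M. interval_decomposable K (\<lambda>A. A \<lesssim> (UNIV :: real set)) (\<lambda>J. True) M} // iso_rel K"

section \<open>The interleaving topology\<close>

text \<open>On isomorphism classes the infimum below is that of a singleton; see
  \<open>class_distance_eq\<close> at the end.\<close>

definition class_distance ::
    "('k, 'm) ring_scheme \<Rightarrow> 'k cpmod set \<Rightarrow> 'k cpmod set \<Rightarrow> ereal" where
  "class_distance K X Y = Inf {interleaving_distance K M N |M N. M \<in> X \<and> N \<in> Y}"

definition interleaving_ball ::
    "('k, 'm) ring_scheme \<Rightarrow> 'k cpmod set set \<Rightarrow> 'k cpmod set \<Rightarrow> real \<Rightarrow> 'k cpmod set set" where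
  "interleaving_ball K S X r = {Y \<in> S. class_distance K X Y < ereal r}"

definition interleaving_topology ::
    "('k, 'm) ring_scheme \<Rightarrow> 'k cpmod set set \<Rightarrow> 'k cpmod set topology" where
  "interleaving_topology K S =
     topology_generated_by {interleaving_ball K S X r |X r. X \<in> S \<and> 0 < r}"

section \<open>Well-definedness on isomorphism classes\<close>

lemma linear_map_closed: "linear_map K V W f \<Longrightarrow> x \<in> carrier V \<Longrightarrow> f x \<in> carrier W"
  by (auto simp: linear_map_def)

lemma linear_map_comp:
  "linear_map K U V f \<Longrightarrow> linear_map K V W g \<Longrightarrow> linear_map K U W (\<lambda>x. g (f x))"
  by (auto simp: linear_map_def Pi_iff)

lemma shift_morphism_closed:
  "shift_morphism K e M N f \<Longrightarrow> x \<in> carrier (obj M a) \<Longrightarrow> f a x \<in> carrier (obj N (a + e))"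
  by (auto simp: shift_morphism_def linear_map_def)

lemma shift_morphism_natural:
  "shift_morphism K e M N f \<Longrightarrow> a \<le> b \<Longrightarrow> x \<in> carrier (obj M a) \<Longrightarrow>
     f b (tr M a b x) = tr N (a + e) (b + e) (f a x)"
  by (auto simp: shift_morphism_def)

lemma shift_morphism_comp:
  assumes f: "shift_morphism K e L M f" and g: "shift_morphism K e' M N g"
  shows "shift_morphism K (e + e') L N (\<lambda>a x. g (a + e) (f a x))"
proof -
  have "linear_map K (obj L a) (obj N (a + (e + e'))) (\<lambda>x. g (a + e) (f a x))" for a
  proof -
    have "linear_map K (obj L a) (obj M (a + e)) (f a)"
      using f by (simp add: shift_morphism_def)
    moreover have "linear_map K (obj M (a + e)) (obj N (a + (e + e'))) (g (a + e))"
      using g by (simp add: shift_morphism_def add.assoc[symmetric])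
    ultimately show ?thesis
      by (rule linear_map_comp)
  qed
  moreover have "g (b + e) (f b (tr L a b x)) =
      tr N (a + (e + e')) (b + (e + e')) (g (a + e) (f a x))"
    if "a \<le> b" "x \<in> carrier (obj L a)" for a b x
    using shift_morphism_natural[OF f that] shift_morphism_closed[OF f that(2)] that(1)
      shift_morphism_natural[OF g, of "a + e" "b + e" "f a x"]
    by (simp add: add.assoc)
  ultimately show ?thesis
    by (auto simp: shift_morphism_def)
qed

lemma linear_map_inv_into:
  assumes V: "Module.module K V"
    and f: "linear_map K V W f" and bij: "bij_betw f (carrier V) (carrier W)"
  shows "linear_map K W V (inv_into (carrier V) f)"
proof -
  let ?g = "inv_into (carrier V) f"
  have inj: "inj_on f (carrier V)"
    using bij by (simp add: bij_betw_def)
  have g: "?g y \<in> carrier V" "f (?g y) = y" if "y \<in> carrier W" for y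
    using that bij by (auto simp: bij_betw_def inv_into_into f_inv_into_f)
  interpret V: Module.module K V by (rule V)
  have "?g (x \<oplus>\<^bsub>W\<^esub> y) = ?g x \<oplus>\<^bsub>V\<^esub> ?g y" if "x \<in> carrier W" "y \<in> carrier W" for x y
  proof -
    have "f (?g x \<oplus>\<^bsub>V\<^esub> ?g y) = x \<oplus>\<^bsub>W\<^esub> y"
      using f g that by (simp add: linear_map_def)
    then show ?thesis
      using inv_into_f_f[OF inj, of "?g x \<oplus>\<^bsub>V\<^esub> ?g y"] g that by simp
  qed
  moreover have "?g (r \<odot>\<^bsub>W\<^esub> x) = r \<odot>\<^bsub>V\<^esub> ?g x" if "r \<in> carrier K" "x \<in> carrier W" for r x
  proof -
    have "f (r \<odot>\<^bsub>V\<^esub> ?g x) = r \<odot>\<^bsub>W\<^esub> x"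
      using f g that by (simp add: linear_map_def)
    then show ?thesis
      using inv_into_f_f[OF inj, of "r \<odot>\<^bsub>V\<^esub> ?g x"] g that by simp
  qed
  ultimately show ?thesis
    using g by (auto simp: linear_map_def)
qed

lemma pm_iso_inverse:
  assumes M: "persistence_module K M" and iso: "pm_iso K M N"
  obtains f g where "shift_morphism K 0 M N f" "shift_morphism K 0 N M g"
    "\<And>a x. x \<in> carrier (obj M a) \<Longrightarrow> g a (f a x) = x"
    "\<And>a y. y \<in> carrier (obj N a) \<Longrightarrow> f a (g a y) = y"
    "\<And>a. bij_betw (f a) (carrier (obj M a)) (carrier (obj N a))"
    "\<And>a. bij_betw (g a) (carrier (obj N a)) (carrier (obj M a))"
proof -
  obtain f where f: "shift_morphism K 0 M N f"
    and bij: "\<And>a. bij_betw (f a) (carrier (obj M a)) (carrier (obj N a))"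
    using iso by (auto simp: pm_iso_def)
  define g where "g = (\<lambda>a. inv_into (carrier (obj M a)) (f a))"
  have inj: "inj_on (f a) (carrier (obj M a))" for a
    using bij[of a] by (simp add: bij_betw_def)
  have gf: "g a (f a x) = x" if "x \<in> carrier (obj M a)" for a x
    using inv_into_f_f[OF inj that] by (simp add: g_def)
  have g: "g a y \<in> carrier (obj M a)" "f a (g a y) = y" if "y \<in> carrier (obj N a)" for a y
    using that bij[of a] unfolding g_def bij_betw_def
    by (auto intro: inv_into_into f_inv_into_f)
  have "linear_map K (obj N a) (obj M (a + 0)) (g a)" for a
    unfolding g_def using M f bij[of a]
    by (auto intro!: linear_map_inv_into simp: persistence_module_def shift_morphism_def)
  moreover have "g b (tr N a b y) = tr M (a + 0) (b + 0) (g a y)"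
    if "a \<le> b" "y \<in> carrier (obj N a)" for a b y
  proof -
    have "tr M a b (g a y) \<in> carrier (obj M b)"
      using M that(1) g(1)[OF that(2)] linear_map_closed[of K "obj M a" "obj M b" "tr M a b" "g a y"]
      by (simp add: persistence_module_def)
    moreover have "f b (tr M a b (g a y)) = tr N a b y"
      using shift_morphism_natural[OF f that(1) g(1)[OF that(2)]] g that by simp
    ultimately show ?thesis
      using gf[of "tr M a b (g a y)" b] by simp
  qed
  ultimately have "shift_morphism K 0 N M g"
    by (auto simp: shift_morphism_def)
  moreover have "bij_betw (g a) (carrier (obj N a)) (carrier (obj M a))" for a
    unfolding g_def by (rule bij_betw_inv_into[OF bij])
  ultimately show thesis
    using that f gf g bij by blast
qed

lemma pm_iso_refl: "pm_iso K M M"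
  by (auto simp: pm_iso_def shift_morphism_def linear_map_def bij_betw_def
      intro!: exI[of _ "\<lambda>_ x. x"])

lemma pm_iso_sym: "persistence_module K M \<Longrightarrow> pm_iso K M N \<Longrightarrow> pm_iso K N M"
  by (erule (1) pm_iso_inverse) (auto simp: pm_iso_def)

lemma pm_iso_trans:
  assumes "pm_iso K L M" "pm_iso K M N"
  shows "pm_iso K L N"
proof -
  obtain f where f: "shift_morphism K 0 L M f"
    "\<And>a. bij_betw (f a) (carrier (obj L a)) (carrier (obj M a))"
    using assms(1) by (auto simp: pm_iso_def)
  obtain g where g: "shift_morphism K 0 M N g"
    "\<And>a. bij_betw (g a) (carrier (obj M a)) (carrier (obj N a))"
    using assms(2) by (auto simp: pm_iso_def)
  have "bij_betw (\<lambda>x. g a (f a x)) (carrier (obj L a)) (carrier (obj N a))" for a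
    using bij_betw_trans[OF f(2) g(2)] by (simp add: o_def)
  then show ?thesis
    using shift_morphism_comp[OF f(1) g(1)] by (auto simp: pm_iso_def)
qed

lemma equiv_iso_rel: "equiv {M. persistence_module K M} (iso_rel K)"
  by (rule equivI)
    (auto simp: iso_rel_def refl_on_def sym_def trans_def
      intro: pm_iso_refl pm_iso_sym pm_iso_trans)

lemma interleaved_sym: "interleaved K e M N \<Longrightarrow> interleaved K e N M"
  unfolding interleaved_def by blast

lemma interleaved_iso_left:
  assumes M: "persistence_module K M" and iso: "pm_iso K M M'"
    and e: "0 \<le> e" and int: "interleaved K e M N"
  shows "interleaved K e M' N"
proof -
  obtain f g where f: "shift_morphism K 0 M M' f" and g: "shift_morphism K 0 M' M g"
    and gf: "\<And>a x. x \<in> carrier (obj M a) \<Longrightarrow> g a (f a x) = x"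
    and fg: "\<And>a y. y \<in> carrier (obj M' a) \<Longrightarrow> f a (g a y) = y"
    by (rule pm_iso_inverse[OF M iso]) blast
  obtain p q where p: "shift_morphism K e M N p" and q: "shift_morphism K e N M q"
    and qp: "\<And>a x. x \<in> carrier (obj M a) \<Longrightarrow> q (a + e) (p a x) = tr M a (a + 2 * e) x"
    and pq: "\<And>a x. x \<in> carrier (obj N a) \<Longrightarrow> p (a + e) (q a x) = tr N a (a + 2 * e) x"
    using int by (auto simp: interleaved_def)
  have p': "shift_morphism K e M' N (\<lambda>a x. p a (g a x))"
    using shift_morphism_comp[OF g p] by simp
  have q': "shift_morphism K e N M' (\<lambda>a x. f (a + e) (q a x))"
    using shift_morphism_comp[OF q f] by simp
  have "f (a + e + e) (q (a + e) (p a (g a x))) = tr M' a (a + 2 * e) x"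
    if x: "x \<in> carrier (obj M' a)" for a x
  proof -
    have gx: "g a x \<in> carrier (obj M a)"
      using shift_morphism_closed[OF g x] by simp
    show ?thesis
      using qp[OF gx] shift_morphism_natural[OF f _ gx, of "a + 2 * e"] fg[OF x] e
      by (simp add: algebra_simps)
  qed
  moreover have "p (a + e) (g (a + e) (f (a + e) (q a x))) = tr N a (a + 2 * e) x"
    if x: "x \<in> carrier (obj N a)" for a x
    using pq[OF x] gf[OF shift_morphism_closed[OF q x]] by simp
  ultimately show ?thesis
    unfolding interleaved_def using p' q' by blast
qed

lemma interleaving_distance_sym: "interleaving_distance K M N = interleaving_distance K N M"
  unfolding interleaving_distance_def by (metis interleaved_sym)

lemma interleaving_distance_iso:
  assumes "(M, M') \<in> iso_rel K" "(N, N') \<in> iso_rel K"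
  shows "interleaving_distance K M N = interleaving_distance K M' N'"
proof -
  have left: "interleaving_distance K L P = interleaving_distance K L' P"
    if "(L, L') \<in> iso_rel K" for L L' P :: "'a cpmod"
  proof -
    have "interleaved K e L P \<longleftrightarrow> interleaved K e L' P" if "0 \<le> e" for e
      using \<open>(L, L') \<in> iso_rel K\<close> that interleaved_iso_left pm_iso_sym
      unfolding iso_rel_def by blast
    then show ?thesis
      unfolding interleaving_distance_def by (metis (no_types, lifting))
  qed
  show ?thesis
    using left[OF assms(1)] left[OF assms(2)] interleaving_distance_sym by metis
qed

lemma class_distance_eq:
  assumes "persistence_module K M" "persistence_module K N"
  shows "class_distance K (iso_rel K `` {M}) (iso_rel K `` {N}) = interleaving_distance K M N"
proof -
  have self: "M \<in> iso_rel K `` {M}" "N \<in> iso_rel K `` {N}"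
    using assms pm_iso_refl by (auto simp: iso_rel_def)
  have "interleaving_distance K M' N' = interleaving_distance K M N"
    if "M' \<in> iso_rel K `` {M}" "N' \<in> iso_rel K `` {N}" for M' N'
    using that interleaving_distance_iso[of M M' K N N'] by simp
  then have "{interleaving_distance K M' N' |M' N'. M' \<in> iso_rel K `` {M} \<and> N' \<in> iso_rel K `` {N}} =
      {interleaving_distance K M N}"
    using self by blast
  then show ?thesis
    by (simp add: class_distance_def)
qed

end

theory Submission
  imports Defs
begin

text \<open>The simple module concentrated at the point \<open>c\<close> (the interval module of the degenerate
  interval \<open>{c}\<close>) and the zero module lie in all seven sets. They are not isomorphic, since their
  values at \<open>c\<close> have different dimensions. But in both of them every map \<open>M(a \<le> b)\<close> with \<open>a < b\<close> is
  zero, so for each \<open>\<epsilon> > 0\<close> the zero morphisms form an \<open>\<epsilon>\<close>-interleaving: the composites have to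
  agree with \<open>M(a \<le> a + 2\<epsilon>)\<close>, which vanishes (\<open>ephemeral_interleaved\<close>). Hence the two modules are
  at distance zero.

  Since interleavings compose (\<open>interleaved_trans\<close>), the distance satisfies the triangle inequality,
  so two modules at distance zero lie in the same balls and therefore in the same open sets
  (\<open>not_t0_space_interleaving_topology\<close>).

  Both modules are written as direct sums of copies of the simple module over a set of at most one
  real index, which places them in the type of persistence modules over which the isomorphism
  classes are formed.\<close>

section \<open>Modules at distance zero are topologically indistinguishable\<close>

lemma interleaved_refl:
  assumes "persistence_module K M"
  shows "interleaved K 0 M M"
  unfolding interleaved_def
proof (intro exI conjI)
  show "shift_morphism K 0 M M (\<lambda>_ x. x)" "shift_morphism K 0 M M (\<lambda>_ x. x)"
    by (auto simp: shift_morphism_def linear_map_def)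
qed (use assms in \<open>auto simp: persistence_module_def\<close>)

text \<open>One of the two round trips of a composite interleaving. The inner round trip through \<open>N\<close> is a
  structure map of \<open>M\<close>, which naturality of \<open>q\<close> moves to \<open>L\<close>, where it follows the outer round
  trip.\<close>

lemma interleaved_round_trip:
  assumes L: "persistence_module K L" and e: "0 \<le> e" "0 \<le> e'"
    and p: "shift_morphism K e L M p" and q: "shift_morphism K e M L q"
    and p': "shift_morphism K e' M N p'"
    and qp: "\<And>a x. x \<in> carrier (obj L a) \<Longrightarrow> q (a + e) (p a x) = tr L a (a + 2 * e) x"
    and qp': "\<And>a x. x \<in> carrier (obj M a) \<Longrightarrow> q' (a + e') (p' a x) = tr M a (a + 2 * e') x"
    and x: "x \<in> carrier (obj L a)"
  shows "q (a + (e + e') + e') (q' (a + (e + e')) (p' (a + e) (p a x))) =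
    tr L a (a + 2 * (e + e')) x"
proof -
  have px: "p a x \<in> carrier (obj M (a + e))"
    using shift_morphism_closed[OF p x] .
  have "q' (a + (e + e')) (p' (a + e) (p a x)) = tr M (a + e) (a + e + 2 * e') (p a x)"
    using qp'[OF px] by (simp add: add.assoc)
  moreover have "q (a + e + 2 * e') (tr M (a + e) (a + e + 2 * e') (p a x)) =
      tr L (a + e + e) (a + e + 2 * e' + e) (q (a + e) (p a x))"
    using shift_morphism_natural[OF q _ px, of "a + e + 2 * e'"] e by simp
  moreover have "tr L (a + 2 * e) (a + 2 * (e + e')) (tr L a (a + 2 * e) x) =
      tr L a (a + 2 * (e + e')) x"
    using L x e unfolding persistence_module_def by simp
  moreover have "a + (e + e') + e' = a + e + 2 * e'" "a + e + e = a + 2 * e"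
    "a + e + 2 * e' + e = a + 2 * (e + e')"
    by simp_all
  ultimately show ?thesis
    using qp[OF x] by metis
qed

lemma interleaved_trans:
  assumes L: "persistence_module K L" and N: "persistence_module K N"
    and e: "0 \<le> e" "0 \<le> e'"
    and LM: "interleaved K e L M" and MN: "interleaved K e' M N"
  shows "interleaved K (e + e') L N"
proof -
  obtain p q where p: "shift_morphism K e L M p" and q: "shift_morphism K e M L q"
    and qp: "\<And>a x. x \<in> carrier (obj L a) \<Longrightarrow> q (a + e) (p a x) = tr L a (a + 2 * e) x"
    and pq: "\<And>a x. x \<in> carrier (obj M a) \<Longrightarrow> p (a + e) (q a x) = tr M a (a + 2 * e) x"
    using LM by (auto simp: interleaved_def)
  obtain p' q' where p': "shift_morphism K e' M N p'" and q': "shift_morphism K e' N M q'"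
    and qp': "\<And>a x. x \<in> carrier (obj M a) \<Longrightarrow> q' (a + e') (p' a x) = tr M a (a + 2 * e') x"
    and pq': "\<And>a x. x \<in> carrier (obj N a) \<Longrightarrow> p' (a + e') (q' a x) = tr N a (a + 2 * e') x"
    using MN by (auto simp: interleaved_def)
  show ?thesis
    unfolding interleaved_def
  proof (intro exI conjI allI ballI)
    show "shift_morphism K (e + e') L N (\<lambda>a x. p' (a + e) (p a x))"
      by (rule shift_morphism_comp[OF p p'])
    show "shift_morphism K (e + e') N L (\<lambda>a x. q (a + e') (q' a x))"
      using shift_morphism_comp[OF q' q] by (simp add: add.commute)
    show "q (a + (e + e') + e') (q' (a + (e + e')) (p' (a + e) (p a x))) =
        tr L a (a + 2 * (e + e')) x" if "x \<in> carrier (obj L a)" for a x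
      by (rule interleaved_round_trip[OF L e p q p' qp qp' that])
    show "p' (a + (e + e') + e) (p (a + (e + e')) (q (a + e') (q' a x))) =
        tr N a (a + 2 * (e + e')) x" if "x \<in> carrier (obj N a)" for a x
      using interleaved_round_trip[OF N e(2,1) q' p' q pq' pq that] by (simp add: add.commute)
  qed
qed

text \<open>The triangle inequality, in the only form needed: a ball containing \<open>M\<close> has room for an
  interleaving with \<open>N\<close> as small as desired, because its radius bound is strict.\<close>

lemma interleaving_distance_less_transfer:
  assumes Z: "persistence_module K Z" and N: "persistence_module K N"
    and MN: "\<And>\<epsilon>. 0 < \<epsilon> \<Longrightarrow> interleaved K \<epsilon> M N"
    and less: "interleaving_distance K Z M < ereal r"
  shows "interleaving_distance K Z N < ereal r"
proof -
  obtain e where e: "0 \<le> e" "interleaved K e Z M" "e < r"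
    using less by (auto simp: interleaving_distance_def Inf_less_iff)
  define \<delta> where "\<delta> = (r - e) / 2"
  have \<delta>: "0 < \<delta>" "e + \<delta> < r"
    using e(3) by (auto simp: \<delta>_def field_simps)
  then have "interleaved K (e + \<delta>) Z N"
    using interleaved_trans[OF Z N e(1) _ e(2) MN] by simp
  then show ?thesis
    using e(1) \<delta> unfolding interleaving_distance_def Inf_less_iff
    by (intro bexI[of _ "ereal (e + \<delta>)"]) auto
qed

lemma not_t0_space_interleaving_topology:
  assumes S: "\<And>Z. Z \<in> S \<Longrightarrow> persistence_module K Z" and MN: "M \<in> S" "N \<in> S"
    and close: "\<And>\<epsilon>. 0 < \<epsilon> \<Longrightarrow> interleaved K \<epsilon> M N" and not_iso: "\<not> pm_iso K M N"
  shows "\<not> t0_space (interleaving_topology K (S // iso_rel K))"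
proof -
  let ?T = "S // iso_rel K" and ?cl = "\<lambda>Z. iso_rel K `` {Z}"
  let ?B = "{interleaving_ball K ?T X r |X r. X \<in> ?T \<and> 0 < r}"
  note M = S[OF MN(1)] and N = S[OF MN(2)]
  have in_T: "?cl Z \<in> ?T" if "Z \<in> S" for Z
    using that by (auto simp: quotient_def)
  have ball_iff: "?cl M \<in> U \<longleftrightarrow> ?cl N \<in> U" if "U \<in> ?B" for U
  proof -
    obtain Z r where Z: "Z \<in> S" and U: "U = interleaving_ball K ?T (?cl Z) r"
      using \<open>U \<in> ?B\<close> by (auto simp: quotient_def)
    have "interleaving_distance K Z M < ereal r \<longleftrightarrow> interleaving_distance K Z N < ereal r"
      using interleaving_distance_less_transfer[OF S[OF Z] N close]
        interleaving_distance_less_transfer[OF S[OF Z] M interleaved_sym[OF close]] by blast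
    then show ?thesis
      using class_distance_eq[OF S[OF Z] M] class_distance_eq[OF S[OF Z] N] in_T MN
      by (simp add: U interleaving_ball_def)
  qed
  have open_iff: "?cl M \<in> U \<longleftrightarrow> ?cl N \<in> U"
    if "openin (interleaving_topology K ?T) U" for U
  proof -
    have "generate_topology_on ?B U"
      using that by (simp add: interleaving_topology_def openin_topology_generated_by_iff)
    then show ?thesis
      by induction (use ball_iff in blast)+
  qed
  have in_space: "?cl Z \<in> topspace (interleaving_topology K ?T)" if "Z \<in> S" for Z
  proof -
    have "interleaving_distance K Z Z < ereal 1"
      using interleaved_refl[OF S[OF that]]
      unfolding interleaving_distance_def Inf_less_iff by (intro bexI[of _ "ereal 0"]) auto
    then have "?cl Z \<in> interleaving_ball K ?T (?cl Z) 1"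
      using class_distance_eq[OF S[OF that] S[OF that]] in_T[OF that]
      by (simp add: interleaving_ball_def)
    then show ?thesis
      using in_T[OF that] zero_less_one
      unfolding interleaving_topology_def topology_generated_by_topspace by blast
  qed
  have "?cl M \<noteq> ?cl N"
    using eq_equiv_class_iff[OF equiv_iso_rel, of M K N] M N not_iso by (auto simp: iso_rel_def)
  then show ?thesis
    using in_space MN open_iff unfolding t0_space_def by metis
qed

section \<open>Ephemeral modules\<close>

text \<open>In the literature a persistence module is called ephemeral if all its non-identity structure
  maps vanish.\<close>

definition ephemeral :: "('k, 'v) pmod \<Rightarrow> bool" where
  "ephemeral M \<longleftrightarrow> (\<forall>a b. a < b \<longrightarrow> (\<forall>x\<in>carrier (obj M a). tr M a b x = \<zero>\<^bsub>obj M b\<^esub>))"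

lemma linear_map_zero:
  assumes "Module.module K V" "Module.module K W" "linear_map K V W f"
  shows "f \<zero>\<^bsub>V\<^esub> = \<zero>\<^bsub>W\<^esub>"
proof -
  interpret V: Module.module K V by fact
  interpret W: Module.module K W by fact
  have "f (\<zero>\<^bsub>K\<^esub> \<odot>\<^bsub>V\<^esub> \<zero>\<^bsub>V\<^esub>) = \<zero>\<^bsub>K\<^esub> \<odot>\<^bsub>W\<^esub> f \<zero>\<^bsub>V\<^esub>"
    using assms(3) V.R.zero_closed V.zero_closed unfolding linear_map_def by blast
  then show ?thesis
    using linear_map_closed[OF assms(3) V.zero_closed] by simp
qed

lemma shift_morphism_zero:
  assumes M: "persistence_module K M" and N: "persistence_module K N"
  shows "shift_morphism K e M N (\<lambda>a _. \<zero>\<^bsub>obj N (a + e)\<^esub>)"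
proof -
  have mods: "Module.module K (obj N a)" for a
    using N by (simp add: persistence_module_def)
  have "linear_map K (obj M a) (obj N (a + e)) (\<lambda>_. \<zero>\<^bsub>obj N (a + e)\<^esub>)" for a
  proof -
    interpret N: Module.module K "obj N (a + e)" by (rule mods)
    show ?thesis by (auto simp: linear_map_def)
  qed
  moreover have "tr N (a + e) (b + e) \<zero>\<^bsub>obj N (a + e)\<^esub> = \<zero>\<^bsub>obj N (b + e)\<^esub>" if "a \<le> b" for a b
    using linear_map_zero[OF mods mods] N that by (simp add: persistence_module_def)
  ultimately show ?thesis
    by (simp add: shift_morphism_def)
qed

text \<open>The zero morphisms form an interleaving, because \<open>a < a + 2\<epsilon>\<close>.\<close>

lemma ephemeral_interleaved:
  assumes "persistence_module K M" "persistence_module K N" "ephemeral M" "ephemeral N" "0 < \<epsilon>"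
  shows "interleaved K \<epsilon> M N"
  unfolding interleaved_def
proof (intro exI conjI)
  show "shift_morphism K \<epsilon> M N (\<lambda>a _. \<zero>\<^bsub>obj N (a + \<epsilon>)\<^esub>)"
    "shift_morphism K \<epsilon> N M (\<lambda>a _. \<zero>\<^bsub>obj M (a + \<epsilon>)\<^esub>)"
    using shift_morphism_zero assms by blast+
  have shift: "a + \<epsilon> + \<epsilon> = a + 2 * \<epsilon>" for a :: real
    by simp
  show "\<forall>a. \<forall>x\<in>carrier (obj M a). \<zero>\<^bsub>obj M (a + \<epsilon> + \<epsilon>)\<^esub> = tr M a (a + 2 * \<epsilon>) x"
    "\<forall>a. \<forall>x\<in>carrier (obj N a). \<zero>\<^bsub>obj N (a + \<epsilon> + \<epsilon>)\<^esub> = tr N a (a + 2 * \<epsilon>) x"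
    unfolding shift using assms(3-5) by (auto simp: ephemeral_def)
qed

section \<open>Interval modules and their direct sums are persistence modules\<close>

lemma persistence_module_interval_module:
  assumes K: "cring K" and J: "is_interval J"
  shows "persistence_module K (interval_module K J)"
proof -
  interpret K: cring K by (rule K)
  have "Module.module K (obj (interval_module K J) a)" for a
  proof (intro Module.moduleI K abelian_groupI)
    show "\<exists>y\<in>carrier (obj (interval_module K J) a).
        y \<oplus>\<^bsub>obj (interval_module K J) a\<^esub> x = \<zero>\<^bsub>obj (interval_module K J) a\<^esub>"
      if "x \<in> carrier (obj (interval_module K J) a)" for x
      using that K.l_neg by (auto simp: interval_module_def split: if_splits)
  qed (auto simp: interval_module_def K.a_ac K.m_ac K.l_distr K.r_distr split: if_splits)
  moreover have "linear_map K (obj (interval_module K J) a) (obj (interval_module K J) b)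
      (tr (interval_module K J) a b)" for a b
    by (simp add: linear_map_def interval_module_def)
  moreover have "tr (interval_module K J) a a x = x"
    if "x \<in> carrier (obj (interval_module K J) a)" for a x
    using that by (simp add: interval_module_def split: if_splits)
  moreover have "tr (interval_module K J) b c (tr (interval_module K J) a b x) =
      tr (interval_module K J) a c x" if "a \<le> b" "b \<le> c" for a b c x
  proof -
    \<comment> \<open>Convexity of \<open>J\<close> is what makes the structure maps compose.\<close>
    have "b \<in> J" if "a \<in> J" "c \<in> J"
      using J that \<open>a \<le> b\<close> \<open>b \<le> c\<close> by (meson is_interval_1)
    then show ?thesis
      by (auto simp: interval_module_def)
  qed
  ultimately show ?thesis
    unfolding persistence_module_def by (intro conjI allI impI ballI) assumption+
qed

lemma module_pm_direct_sum:
  assumes K: "cring K" and N: "\<And>i. i \<in> A \<Longrightarrow> Module.module K (obj (N i) a)"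
  shows "Module.module K (obj (pm_direct_sum A N) a)"
proof -
  let ?V = "obj (pm_direct_sum A N) a"
  let ?supp = "\<lambda>x. {i \<in> A. x i \<noteq> \<zero>\<^bsub>obj (N i) a\<^esub>}"
  note ab = Module.module.axioms(2)[OF N]
  note facts = abelian_groupE(1,2,5)[OF ab]
    Module.module.smult_closed[OF N] Module.module.smult_one[OF N] Module.module.smult_r_null[OF N]
  interpret K: cring K by (rule K)
  have carrier: "x \<in> carrier ?V \<longleftrightarrow>
      x \<in> extensional A \<and> (\<forall>i\<in>A. x i \<in> carrier (obj (N i) a)) \<and> finite (?supp x)" for x
    by (auto simp: pm_direct_sum_def PiE_iff)
  have ops: "\<zero>\<^bsub>?V\<^esub> = (\<lambda>i\<in>A. \<zero>\<^bsub>obj (N i) a\<^esub>)" "x \<oplus>\<^bsub>?V\<^esub> y = (\<lambda>i\<in>A. x i \<oplus>\<^bsub>obj (N i) a\<^esub> y i)"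
    "r \<odot>\<^bsub>?V\<^esub> x = (\<lambda>i\<in>A. r \<odot>\<^bsub>obj (N i) a\<^esub> x i)" for x y r
    by (simp_all add: pm_direct_sum_def)
  have add_closed: "x \<oplus>\<^bsub>?V\<^esub> y \<in> carrier ?V" if "x \<in> carrier ?V" "y \<in> carrier ?V" for x y
  proof -
    have "finite (?supp (\<lambda>i\<in>A. x i \<oplus>\<^bsub>obj (N i) a\<^esub> y i))"
      by (rule finite_subset[of _ "?supp x \<union> ?supp y"])
        (use that in \<open>auto simp: carrier facts\<close>)
    then show ?thesis
      using that by (simp add: carrier ops facts)
  qed
  have smult_closed: "r \<odot>\<^bsub>?V\<^esub> x \<in> carrier ?V" if "r \<in> carrier K" "x \<in> carrier ?V" for r x
  proof -
    have "finite (?supp (\<lambda>i\<in>A. r \<odot>\<^bsub>obj (N i) a\<^esub> x i))"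
      by (rule finite_subset[of _ "?supp x"]) (use that in \<open>auto simp: carrier facts\<close>)
    then show ?thesis
      using that by (simp add: carrier ops facts)
  qed
  have zero_closed: "\<zero>\<^bsub>?V\<^esub> \<in> carrier ?V"
    by (simp add: carrier ops facts)
  \<comment> \<open>Taking \<open>(-1) \<odot> x\<close> as the negative of \<open>x\<close> makes its finite support a case of closure under
    scalar multiplication.\<close>
  have negative: "\<exists>y\<in>carrier ?V. y \<oplus>\<^bsub>?V\<^esub> x = \<zero>\<^bsub>?V\<^esub>" if "x \<in> carrier ?V" for x
  proof
    show "(\<ominus>\<^bsub>K\<^esub> \<one>\<^bsub>K\<^esub>) \<odot>\<^bsub>?V\<^esub> x \<oplus>\<^bsub>?V\<^esub> x = \<zero>\<^bsub>?V\<^esub>"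
      using that abelian_group.l_neg[OF ab] Module.module.smult_l_minus[OF N]
      by (auto simp: ops carrier facts intro!: restrict_ext)
    show "(\<ominus>\<^bsub>K\<^esub> \<one>\<^bsub>K\<^esub>) \<odot>\<^bsub>?V\<^esub> x \<in> carrier ?V"
      using that by (intro smult_closed) simp_all
  qed
  show ?thesis
  proof (intro Module.moduleI K abelian_groupI)
    show "\<zero>\<^bsub>?V\<^esub> \<oplus>\<^bsub>?V\<^esub> x = x" "\<one>\<^bsub>K\<^esub> \<odot>\<^bsub>?V\<^esub> x = x" if "x \<in> carrier ?V" for x
      using that by (auto simp: ops carrier facts intro!: extensionalityI[of _ A])
    show "x \<oplus>\<^bsub>?V\<^esub> y = y \<oplus>\<^bsub>?V\<^esub> x" if "x \<in> carrier ?V" "y \<in> carrier ?V" for x y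
      using that abelian_groupE(4)[OF ab] by (auto simp: ops carrier intro!: restrict_ext)
    show "x \<oplus>\<^bsub>?V\<^esub> y \<oplus>\<^bsub>?V\<^esub> z = x \<oplus>\<^bsub>?V\<^esub> (y \<oplus>\<^bsub>?V\<^esub> z)"
      if "x \<in> carrier ?V" "y \<in> carrier ?V" "z \<in> carrier ?V" for x y z
      using that abelian_groupE(3)[OF ab] by (auto simp: ops carrier intro!: restrict_ext)
    show "(r \<oplus>\<^bsub>K\<^esub> s) \<odot>\<^bsub>?V\<^esub> x = r \<odot>\<^bsub>?V\<^esub> x \<oplus>\<^bsub>?V\<^esub> s \<odot>\<^bsub>?V\<^esub> x"
      "(r \<otimes>\<^bsub>K\<^esub> s) \<odot>\<^bsub>?V\<^esub> x = r \<odot>\<^bsub>?V\<^esub> (s \<odot>\<^bsub>?V\<^esub> x)"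
      if "r \<in> carrier K" "s \<in> carrier K" "x \<in> carrier ?V" for r s x
      using that Module.module.smult_l_distr[OF N] Module.module.smult_assoc1[OF N]
      by (auto simp: ops carrier intro!: restrict_ext)
    show "r \<odot>\<^bsub>?V\<^esub> (x \<oplus>\<^bsub>?V\<^esub> y) = r \<odot>\<^bsub>?V\<^esub> x \<oplus>\<^bsub>?V\<^esub> r \<odot>\<^bsub>?V\<^esub> y"
      if "r \<in> carrier K" "x \<in> carrier ?V" "y \<in> carrier ?V" for r x y
      using that Module.module.smult_r_distr[OF N]
      by (auto simp: ops carrier intro!: restrict_ext)
  qed (fact add_closed smult_closed zero_closed negative)+
qed

lemma persistence_module_pm_direct_sum:
  assumes K: "cring K" and N: "\<And>i. i \<in> A \<Longrightarrow> persistence_module K (N i)"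
  shows "persistence_module K (pm_direct_sum A N)"
proof -
  have mod: "Module.module K (obj (N i) a)" if "i \<in> A" for i a
    using N[OF that] by (simp add: persistence_module_def)
  have lin: "linear_map K (obj (N i) a) (obj (N i) b) (tr (N i) a b)" if "i \<in> A" "a \<le> b" for i a b
    using N[OF that(1)] that(2) by (simp add: persistence_module_def)
  have "finite {i \<in> A. tr (N i) a b (x i) \<noteq> \<zero>\<^bsub>obj (N i) b\<^esub>}"
    if "a \<le> b" "finite {i \<in> A. x i \<noteq> \<zero>\<^bsub>obj (N i) a\<^esub>}" for a b x
    by (rule finite_subset[OF _ that(2)]) (use linear_map_zero[OF mod mod lin] that(1) in auto)
  then have "tr (pm_direct_sum A N) a b x \<in> carrier (obj (pm_direct_sum A N) b)"
    if "a \<le> b" "x \<in> carrier (obj (pm_direct_sum A N) a)" for a b x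
    using linear_map_closed[OF lin] that
    by (simp add: pm_direct_sum_def PiE_iff cong: conj_cong)
  then have "linear_map K (obj (pm_direct_sum A N) a) (obj (pm_direct_sum A N) b)
      (tr (pm_direct_sum A N) a b)" if "a \<le> b" for a b
    using lin that unfolding linear_map_def
    by (auto simp: pm_direct_sum_def PiE_iff intro!: restrict_ext)
  moreover have "Module.module K (obj (pm_direct_sum A N) a)" for a
    by (rule module_pm_direct_sum[OF K]) (rule mod)
  moreover have "tr (pm_direct_sum A N) a a x = x"
    if "x \<in> carrier (obj (pm_direct_sum A N) a)" for a x
    using N that
    by (auto simp: pm_direct_sum_def persistence_module_def PiE_iff intro!: extensionalityI[of _ A])
  moreover have "tr (pm_direct_sum A N) b c (tr (pm_direct_sum A N) a b x) =
      tr (pm_direct_sum A N) a c x"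
    if "a \<le> b" "b \<le> c" "x \<in> carrier (obj (pm_direct_sum A N) a)" for a b c x
    using N that by (auto simp: pm_direct_sum_def persistence_module_def PiE_iff intro!: restrict_ext)
  ultimately show ?thesis
    unfolding persistence_module_def by (intro conjI allI impI ballI) assumption+
qed

section \<open>The simple module at a point and the zero module\<close>

text \<open>The zero module is the case \<open>A = {}\<close>, the simple module at \<open>p\<close> the case where \<open>A\<close> is a
  singleton.\<close>

definition point_sum :: "('k, 'm) ring_scheme \<Rightarrow> real \<Rightarrow> real set \<Rightarrow> 'k cpmod" where
  "point_sum K p A = pm_direct_sum A (\<lambda>_. interval_module K {p})"

lemma carrier_point_sum:
  "carrier (obj (point_sum K p A) a) =
     {x \<in> A \<rightarrow>\<^sub>E (if a = p then carrier K else {\<zero>\<^bsub>K\<^esub>}). finite {i \<in> A. x i \<noteq> \<zero>\<^bsub>K\<^esub>}}"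
  by (simp add: point_sum_def pm_direct_sum_def interval_module_def)

lemma persistence_module_point_sum: "cring K \<Longrightarrow> persistence_module K (point_sum K p A)"
  unfolding point_sum_def
  by (intro persistence_module_pm_direct_sum persistence_module_interval_module)
    (auto simp: is_interval_1)

lemma interval_decomposable_point_sum:
  assumes "cring K" "P A" "Q {p}"
  shows "interval_decomposable K P Q (point_sum K p A)"
  unfolding interval_decomposable_def
proof (intro conjI exI)
  show "persistence_module K (point_sum K p A)"
    using assms(1) by (rule persistence_module_point_sum)
  show "pm_iso K (point_sum K p A) (pm_direct_sum A (\<lambda>_. interval_module K {p}))"
    unfolding point_sum_def by (rule pm_iso_refl)
qed (use assms in \<open>auto simp: is_interval_1\<close>)

text \<open>A strict inequality \<open>a < b\<close> leaves no room for both \<open>a\<close> and \<open>b\<close> in \<open>{p}\<close>.\<close>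

lemma ephemeral_point_sum: "ephemeral (point_sum K p A)"
  by (auto simp: ephemeral_def point_sum_def pm_direct_sum_def interval_module_def)

lemma fin_dim_if_generated_by_one:
  assumes "Module.module K V" "e \<in> carrier V"
    and "\<And>x. x \<in> carrier V \<Longrightarrow> \<exists>r\<in>carrier K. x = r \<odot>\<^bsub>V\<^esub> e"
  shows "fin_dim K V"
proof -
  interpret V: Module.module K V by fact
  have "\<exists>r\<in>{e} \<rightarrow> carrier K. x = (\<Oplus>\<^bsub>V\<^esub>b\<in>{e}. r b \<odot>\<^bsub>V\<^esub> b)" if x: "x \<in> carrier V" for x
  proof -
    obtain r where "r \<in> carrier K" "x = r \<odot>\<^bsub>V\<^esub> e"
      using assms(3)[OF x] by blast
    then show ?thesis
      using assms(2) by (intro bexI[of _ "\<lambda>_. r"]) auto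
  qed
  then show ?thesis
    using assms(2) by (auto simp: fin_dim_def intro!: exI[of _ "{e}"])
qed

lemma fin_dim_point_sum:
  assumes K: "cring K" and A: "A \<subseteq> {i}"
  shows "fin_dim K (obj (point_sum K p A) a)"
proof -
  interpret K: cring K by (rule K)
  let ?V = "obj (point_sum K p A) a"
  let ?e = "\<lambda>j\<in>A. if a = p then \<one>\<^bsub>K\<^esub> else \<zero>\<^bsub>K\<^esub>"
  show ?thesis
  proof (rule fin_dim_if_generated_by_one)
    show "Module.module K ?V"
      using persistence_module_point_sum[OF K] by (simp add: persistence_module_def)
    have "finite A"
      using A finite_subset by blast
    then show "?e \<in> carrier ?V"
      by (simp add: carrier_point_sum)
    \<comment> \<open>For empty \<open>A\<close> the coefficient \<open>x i\<close> would be undefined, and any scalar serves.\<close>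
    show "\<exists>r\<in>carrier K. x = r \<odot>\<^bsub>?V\<^esub> ?e" if x: "x \<in> carrier ?V" for x
    proof (rule bexI)
      show "(if i \<in> A then x i else \<zero>\<^bsub>K\<^esub>) \<in> carrier K"
        using x by (auto simp: carrier_point_sum PiE_iff split: if_splits)
      show "x = (if i \<in> A then x i else \<zero>\<^bsub>K\<^esub>) \<odot>\<^bsub>?V\<^esub> ?e"
        using x A
        by (auto simp: carrier_point_sum point_sum_def pm_direct_sum_def interval_module_def PiE_iff
            intro!: extensionalityI[of x A] split: if_splits)
    qed
  qed
qed

lemma not_iso_point_sum:
  assumes K: "field K"
  shows "\<not> pm_iso K (point_sum K p {}) (point_sum K p {i})"
proof
  interpret K: field K by (rule K)
  assume "pm_iso K (point_sum K p {}) (point_sum K p {i})"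
  then obtain f where
    "bij_betw f (carrier (obj (point_sum K p {}) p)) (carrier (obj (point_sum K p {i}) p))"
    by (auto simp: pm_iso_def)
  moreover have "carrier (obj (point_sum K p {}) p) = {\<lambda>_. undefined}"
    by (auto simp: carrier_point_sum)
  ultimately have "carrier (obj (point_sum K p {i}) p) = {f (\<lambda>_. undefined)}"
    by (simp add: bij_betw_def)
  moreover have "(\<lambda>j\<in>{i}. r) \<in> carrier (obj (point_sum K p {i}) p)" if "r \<in> carrier K" for r
    using that by (simp add: carrier_point_sum)
  ultimately have "(\<lambda>j\<in>{i}. \<zero>\<^bsub>K\<^esub>) = (\<lambda>j\<in>{i}. \<one>\<^bsub>K\<^esub>)"
    using K.zero_closed K.one_closed by (metis singletonD)
  then show False
    using K.zero_not_one by (metis restrict_apply singletonI)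
qed

lemma not_t0_space_if_point_sums:
  assumes K: "field K" and S: "\<And>Z. Z \<in> S \<Longrightarrow> persistence_module K Z"
    and mem: "\<And>A. A \<subseteq> {p} \<Longrightarrow> point_sum K p A \<in> S"
  shows "\<not> t0_space (interleaving_topology K (S // iso_rel K))"
proof (rule not_t0_space_interleaving_topology[OF S])
  interpret field K by (rule K)
  show "interleaved K \<epsilon> (point_sum K p {}) (point_sum K p {p})" if "0 < \<epsilon>" for \<epsilon>
    using ephemeral_interleaved persistence_module_point_sum ephemeral_point_sum is_cring that
    by blast
  show "\<not> pm_iso K (point_sum K p {}) (point_sum K p {p})"
    by (rule not_iso_point_sum[OF K])
qed (use mem in auto)

theorem corollary4p6:
  fixes K :: "('k, 'm) ring_scheme" and c d :: real
  assumes "field K" and "c < d"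
  shows "\<not> t0_space (interleaving_topology K (ffid_within K c d)) \<and>
         \<not> t0_space (interleaving_topology K (ffid K)) \<and>
         \<not> t0_space (interleaving_topology K (fid K)) \<and>
         \<not> t0_space (interleaving_topology K (cfid K)) \<and>
         \<not> t0_space (interleaving_topology K (cid K)) \<and>
         \<not> t0_space (interleaving_topology K (pfd K)) \<and>
         \<not> t0_space (interleaving_topology K (rid K))"
proof -
  interpret field K by (rule assms(1))
  have decomposable:
    "\<not> t0_space (interleaving_topology K ({M. interval_decomposable K P Q M} // iso_rel K))"
    if "\<And>A. A \<subseteq> {c} \<Longrightarrow> P A" "Q {c}" for P Q
    using that interval_decomposable_point_sum[OF is_cring]
    by (intro not_t0_space_if_point_sums[OF assms(1), where p = c])
      (auto simp: interval_decomposable_def)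
  have fin: "finite A" if "A \<subseteq> {c}" for A
    using that finite_subset by blast
  have "\<not> t0_space (interleaving_topology K (pfd K))"
    unfolding pfd_def
    using fin_dim_point_sum[OF is_cring] persistence_module_point_sum[OF is_cring]
    by (intro not_t0_space_if_point_sums[OF assms(1), where p = c]) auto
  moreover have "\<not> t0_space (interleaving_topology K (ffid_within K c d))"
    unfolding ffid_within_def using fin assms(2) by (intro decomposable) auto
  moreover have "\<not> t0_space (interleaving_topology K (ffid K))"
    "\<not> t0_space (interleaving_topology K (fid K))"
    "\<not> t0_space (interleaving_topology K (cfid K))"
    "\<not> t0_space (interleaving_topology K (cid K))"
    "\<not> t0_space (interleaving_topology K (rid K))"
    unfolding ffid_def fid_def cfid_def cid_def rid_def
    using fin by (simp_all add: decomposable countable_finite subset_imp_lepoll)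
  ultimately show ?thesis
    by blast
qed

end
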